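(* Given a sortition instance with $\mathcal P\neq\emptyset$ and weights $\mu\in\mathbb R_{>0}^N$, and for whatever nonempty feature subset $F'\subseteq F$ is used by the algorithm, the weighted MaxEntropy algorithm (defined in the context) samples a panel according to $\lambda_\mu$: for every $P\in\mathcal P$, it outputs $P$ with probability $$\lambda_\mu(P)=\frac{\prod_{i\in P}\mu_i}{\sum_{Q\in\mathcal P}\prod_{i\in Q}\mu_i}.$$
   Context: Sortition instance: pool members $N=\{1,\dots,n\}$; a finite nonempty set $F$ of features, each a function $f:N\to V_f$ to a finite set; a panel size $k$; integer quotas $0\le\ell_{f,v}\le u_{f,v}\le k$ for all $f\in F,v\in V_f$. A panel is a set $P\subseteq N$ with $|P|=k$ and $\ell_{f,v}\le|\{i\in P:f(i)=v\}|\le u_{f,v}$ for all $f\in F,v\in V_f$; $\mathcal P$ is the set of panels. Weighted MaxEntropy: fix a nonempty $F'\subseteq F$; repeat drawing independent samples with the Exact Sampling procedure for $F'$ and $\mu$ below until the sample $P$ lies in $\mathcal P$; return that $P$. Exact Sampling for $F'$: let $FV'=\{(f,v):f\in F',v\in V_f\}$; for $i\in N$ let $w'(i)\in\{0,1\}^{FV'}$ have $w'(i)_{f,v}=1$ if $f(i)=v$ and $0$ otherwise; $w'(U)=\sum_{i\in U}w'(i)$. Fix $f_0\in F'$; $\overline{\mathcal Z}'$ is the set of $z\in\mathbb N^{FV'}$ (with $0\in\mathbb N$) with $\ell_{f,v}\le z_{f,v}\le u_{f,v}$ for all $(f,v)\in FV'$ and $\sum_{v\in V_{f_0}}z_{f_0,v}=k$.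 Let $\omega_1,\dots,\omega_M$ be an ordering of the distinct vectors $\{w'(i):i\in N\}$, $N|_{\omega_j}=\{i:w'(i)=\omega_j\}$, $n_{\omega_j}=|N|_{\omega_j}|$, $N_j=\bigcup_{j'\ge j}N|_{\omega_{j'}}$ for $1\le j\le M+1$, $$\varphi'_\mu(j,z)=\sum_{U\subseteq N_j:\ z+w'(U)\in\overline{\mathcal Z}'}\prod_{t\in U}\mu_t,\qquad C_\mu(j,d)=\sum_{S\subseteq N|_{\omega_j},\,|S|=d}\prod_{i\in S}\mu_i,$$ $$p_{j,z}(d)=\frac{C_\mu(j,d)\,\varphi'_\mu(j+1,z+d\omega_j)}{\varphi'_\mu(j,z)}\ \ (0\le d\le n_{\omega_j}),\qquad q_{j,d}(S)=\frac{\prod_{i\in S}\mu_i}{C_\mu(j,d)}\ \ (S\subseteq N|_{\omega_j},|S|=d).$$ Start with $(j,z)=(1,\vec0)$ and $P=\emptyset$. While $j\le M$: sample $d$ from $p_{j,z}$, then $S$ from $q_{j,d}$, replace $P$ by $P\cup S$ and $(j,z)$ by $(j+1,z+d\omega_j)$. Return $P$. *)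

theory Defs
  imports "HOL-Probability.Probability"
begin

text \<open>
  A feature is itself a function on the pool. The value sets and quotas are indexed by the feature;
  all value sets live in one common type.
\<close>

record 'v sortition =
  pool_size  :: nat
  features   :: "(nat \<Rightarrow> 'v) set"
  vals       :: "(nat \<Rightarrow> 'v) \<Rightarrow> 'v set"
  panel_size :: nat
  lower      :: "(nat \<Rightarrow> 'v) \<Rightarrow> 'v \<Rightarrow> nat"
  upper      :: "(nat \<Rightarrow> 'v) \<Rightarrow> 'v \<Rightarrow> nat"

definition pool :: "'v sortition \<Rightarrow> nat set" where
  "pool I = {1..pool_size I}"

definition sortition_instance :: "'v sortition \<Rightarrow> bool" where
  "sortition_instance I \<longleftrightarrow>
     finite (features I) \<and> features I \<noteq> {} \<and>
     (\<forall>f\<in>features I. finite (vals I f) \<and> f \<in> pool I \<rightarrow> vals I f \<and>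
        (\<forall>v\<in>vals I f. lower I f v \<le> upper I f v \<and> upper I f v \<le> panel_size I))"

definition panels :: "'v sortition \<Rightarrow> nat set set" where
  "panels I = {P. P \<subseteq> pool I \<and> card P = panel_size I \<and>
     (\<forall>f\<in>features I. \<forall>v\<in>vals I f.
        lower I f v \<le> card {i\<in>P. f i = v} \<and> card {i\<in>P. f i = v} \<le> upper I f v)}"


text \<open>
  Vectors with coordinates in a set of feature-value pairs are functions on all pairs that vanish
  outside that set, so that equality of vectors is equality of functions.
\<close>

type_synonym 'v fvec = "(nat \<Rightarrow> 'v) \<times> 'v \<Rightarrow> nat"

definition feature_values :: "'v sortition \<Rightarrow> (nat \<Rightarrow> 'v) set \<Rightarrow> ((nat \<Rightarrow> 'v) \<times> 'v) set" where
  "feature_values I F' = (SIGMA f:F'. vals I f)"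

definition wvec :: "'v sortition \<Rightarrow> (nat \<Rightarrow> 'v) set \<Rightarrow> nat \<Rightarrow> 'v fvec" where
  "wvec I F' i = (\<lambda>(f, v). if (f, v) \<in> feature_values I F' \<and> f i = v then 1 else 0)"

definition wvec_set :: "'v sortition \<Rightarrow> (nat \<Rightarrow> 'v) set \<Rightarrow> nat set \<Rightarrow> 'v fvec" where
  "wvec_set I F' U = (\<lambda>p. \<Sum>i\<in>U. wvec I F' i p)"

definition Zbar :: "'v sortition \<Rightarrow> (nat \<Rightarrow> 'v) set \<Rightarrow> (nat \<Rightarrow> 'v) \<Rightarrow> 'v fvec set" where
  "Zbar I F' f\<^sub>0 = {z.
     (\<forall>p. p \<notin> feature_values I F' \<longrightarrow> z p = 0) \<and>
     (\<forall>(f, v)\<in>feature_values I F'. lower I f v \<le> z (f, v) \<and> z (f, v) \<le> upper I f v) \<and>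
     (\<Sum>v\<in>vals I f\<^sub>0. z (f\<^sub>0, v)) = panel_size I}"


text \<open>
  The ordering of the distinct vectors is given by \<open>M\<close> and the values \<open>\<omega> 1, \<dots>, \<omega> M\<close>.
\<close>

definition members_with :: "'v sortition \<Rightarrow> (nat \<Rightarrow> 'v) set \<Rightarrow> 'v fvec \<Rightarrow> nat set" where
  "members_with I F' w = {i\<in>pool I. wvec I F' i = w}"

definition members_from ::
  "'v sortition \<Rightarrow> (nat \<Rightarrow> 'v) set \<Rightarrow> nat \<Rightarrow> (nat \<Rightarrow> 'v fvec) \<Rightarrow> nat \<Rightarrow> nat set" where
  "members_from I F' M \<omega> j = (\<Union>j'\<in>{j..M}. members_with I F' (\<omega> j'))"

definition phi ::
  "'v sortition \<Rightarrow> (nat \<Rightarrow> 'v) set \<Rightarrow> (nat \<Rightarrow> 'v) \<Rightarrow> nat \<Rightarrow> (nat \<Rightarrow> 'v fvec) \<Rightarrow> (nat \<Rightarrow> real) \<Rightarrow>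
    nat \<Rightarrow> 'v fvec \<Rightarrow> real" where
  "phi I F' f\<^sub>0 M \<omega> \<mu> j z =
     (\<Sum>U | U \<subseteq> members_from I F' M \<omega> j \<and> (\<lambda>p. z p + wvec_set I F' U p) \<in> Zbar I F' f\<^sub>0.
        \<Prod>t\<in>U. \<mu> t)"

definition subset_weight ::
  "'v sortition \<Rightarrow> (nat \<Rightarrow> 'v) set \<Rightarrow> (nat \<Rightarrow> 'v fvec) \<Rightarrow> (nat \<Rightarrow> real) \<Rightarrow> nat \<Rightarrow> nat \<Rightarrow> real" where
  "subset_weight I F' \<omega> \<mu> j d = (\<Sum>S | S \<subseteq> members_with I F' (\<omega> j) \<and> card S = d. \<Prod>i\<in>S. \<mu> i)"

definition add_copies :: "'v fvec \<Rightarrow> nat \<Rightarrow> 'v fvec \<Rightarrow> 'v fvec" where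
  "add_copies z d w = (\<lambda>p. z p + d * w p)"

text \<open>
  Both sampling distributions are given by their mass functions. \<^const>\<open>embed_pmf\<close> returns the
  distribution with that mass function only when the masses are nonnegative and sum to 1, and is
  unspecified otherwise (for instance where \<^const>\<open>phi\<close> is 0). That the masses are
  admissible at every reached state is therefore a proof obligation, not an assumption.
\<close>

definition count_dist ::
  "'v sortition \<Rightarrow> (nat \<Rightarrow> 'v) set \<Rightarrow> (nat \<Rightarrow> 'v) \<Rightarrow> nat \<Rightarrow> (nat \<Rightarrow> 'v fvec) \<Rightarrow> (nat \<Rightarrow> real) \<Rightarrow>
    nat \<Rightarrow> 'v fvec \<Rightarrow> nat pmf" where
  "count_dist I F' f\<^sub>0 M \<omega> \<mu> j z = embed_pmf (\<lambda>d.
     if d \<le> card (members_with I F' (\<omega> j))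
     then subset_weight I F' \<omega> \<mu> j d * phi I F' f\<^sub>0 M \<omega> \<mu> (j + 1) (add_copies z d (\<omega> j))
            / phi I F' f\<^sub>0 M \<omega> \<mu> j z
     else 0)"

definition subset_dist ::
  "'v sortition \<Rightarrow> (nat \<Rightarrow> 'v) set \<Rightarrow> (nat \<Rightarrow> 'v fvec) \<Rightarrow> (nat \<Rightarrow> real) \<Rightarrow>
    nat \<Rightarrow> nat \<Rightarrow> nat set pmf" where
  "subset_dist I F' \<omega> \<mu> j d = embed_pmf (\<lambda>S.
     if S \<subseteq> members_with I F' (\<omega> j) \<and> card S = d
     then (\<Prod>i\<in>S. \<mu> i) / subset_weight I F' \<omega> \<mu> j d
     else 0)"

function exact_sampling_loop ::
  "'v sortition \<Rightarrow> (nat \<Rightarrow> 'v) set \<Rightarrow> (nat \<Rightarrow> 'v) \<Rightarrow> nat \<Rightarrow> (nat \<Rightarrow> 'v fvec) \<Rightarrow> (nat \<Rightarrow> real) \<Rightarrow>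
    nat \<Rightarrow> 'v fvec \<Rightarrow> nat set \<Rightarrow> nat set pmf" where
  "exact_sampling_loop I F' f\<^sub>0 M \<omega> \<mu> j z P =
     (if j \<le> M then
        do {
          d \<leftarrow> count_dist I F' f\<^sub>0 M \<omega> \<mu> j z;
          S \<leftarrow> subset_dist I F' \<omega> \<mu> j d;
          exact_sampling_loop I F' f\<^sub>0 M \<omega> \<mu> (j + 1) (add_copies z d (\<omega> j)) (P \<union> S)
        }
      else return_pmf P)"
  by pat_completeness auto
termination
  by (relation "Wellfounded.measure (\<lambda>(I, F', f\<^sub>0, M, \<omega>, \<mu>, j, z, P). M + 1 - j)") auto

declare exact_sampling_loop.simps [simp del]

definition exact_sampling ::
  "'v sortition \<Rightarrow> (nat \<Rightarrow> 'v) set \<Rightarrow> (nat \<Rightarrow> 'v) \<Rightarrow> nat \<Rightarrow> (nat \<Rightarrow> 'v fvec) \<Rightarrow> (nat \<Rightarrow> real) \<Rightarrow>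
    nat set pmf" where
  "exact_sampling I F' f\<^sub>0 M \<omega> \<mu> = exact_sampling_loop I F' f\<^sub>0 M \<omega> \<mu> 1 (\<lambda>_. 0) {}"

text \<open>
  Independent draws from \<open>D\<close> are repeated until one lies in \<open>A\<close>. As a least fixed point of
  subprobability distributions, any probability of never stopping appears as missing mass.
\<close>

partial_function (spmf) repeat_until :: "'a pmf \<Rightarrow> 'a set \<Rightarrow> 'a spmf" where
  "repeat_until D A =
     bind_spmf (spmf_of_pmf D) (\<lambda>x. if x \<in> A then return_spmf x else repeat_until D A)"

definition weighted_max_entropy ::
  "'v sortition \<Rightarrow> (nat \<Rightarrow> 'v) set \<Rightarrow> (nat \<Rightarrow> 'v) \<Rightarrow> nat \<Rightarrow> (nat \<Rightarrow> 'v fvec) \<Rightarrow> (nat \<Rightarrow> real) \<Rightarrow>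
    nat set spmf" where
  "weighted_max_entropy I F' f\<^sub>0 M \<omega> \<mu> =
     repeat_until (exact_sampling I F' f\<^sub>0 M \<omega> \<mu>) (panels I)"

end

theory Submission
  imports Defs
begin

text \<open>
  A set \<open>U\<close> arises along the single path that draws, at step \<open>j\<close>, the part of \<open>U\<close>
  lying in the \<open>j\<close>-th class. The transition masses along that path telescope to
  \<open>(\<Prod>i\<in>U. \<mu> i) / phi 1 0\<close>. It is enough to show this as a lower bound for the output
  probability, because these lower bounds already sum to \<open>1\<close>. The unfolding of the rejection loop
  then determines the output law by a linear equation, which has a unique solution since the
  acceptance probability is positive.
\<close>

section \<open>Finite mass functions and rejection sampling\<close>

text \<open>Admissibility for \<open>embed_pmf\<close>, checked once for both sampling
  distributions: each has the form of finitely many numerators \<open>g x\<close> over a common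
  normaliser \<open>s\<close>, so only the sum of the numerators has to be computed.\<close>

lemma pmf_embed_pmf_finite:
  fixes g :: "'a \<Rightarrow> real"
  assumes "finite {x. A x}" and "\<And>x. A x \<Longrightarrow> 0 \<le> g x" and "(\<Sum>x | A x. g x) = s" and "0 < s"
  shows "pmf (embed_pmf (\<lambda>x. if A x then g x / s else 0)) x = (if A x then g x / s else 0)"
proof (rule pmf_embed_pmf)
  fix x
  show "0 \<le> (if A x then g x / s else 0)"
    using assms by simp
  have "(\<integral>\<^sup>+x. ennreal (if A x then g x / s else 0) \<partial>count_space UNIV) =
      (\<Sum>x | A x. ennreal (if A x then g x / s else 0))"
    by (rule nn_integral_count_space') (use assms in auto)
  also have "\<dots> = ennreal (\<Sum>x | A x. g x / s)"
    using assms by (subst sum_ennreal[symmetric]) auto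
  also have "(\<Sum>x | A x. g x / s) = 1"
    using assms by (simp flip: sum_divide_distrib)
  finally show "(\<integral>\<^sup>+x. ennreal (if A x then g x / s else 0) \<partial>count_space UNIV) = 1"
    by simp
qed

text \<open>Of the integral over all intermediate values only the contribution of \<open>x\<close>
  is kept.\<close>

lemma pmf_bind_ge: "pmf p x * pmf (f x) y \<le> pmf (bind_pmf p f) y"
proof -
  have "ennreal (pmf p x * pmf (f x) y)
      = (\<integral>\<^sup>+x'. ennreal (pmf (f x') y) * indicator {x} x' \<partial>measure_pmf p)"
    by (simp add: nn_integral_indicator_singleton emeasure_pmf_single ennreal_mult' mult.commute)
  also have "\<dots> \<le> (\<integral>\<^sup>+x'. ennreal (pmf (f x') y) \<partial>measure_pmf p)"
    by (rule nn_integral_mono) (auto simp: indicator_def)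
  also have "\<dots> = ennreal (pmf (bind_pmf p f) y)"
    by (simp add: ennreal_pmf_bind)
  finally show ?thesis
    by simp
qed

text \<open>The mass of \<open>p\<close> on \<open>A\<close> is at most 1, so lower bounds with sum
  1 leave no slack in any term.\<close>

lemma pmf_eq_if_le_sum_1:
  assumes "finite A" and "\<And>x. x \<in> A \<Longrightarrow> g x \<le> pmf p x" and "(\<Sum>x\<in>A. g x) = 1" and "x \<in> A"
  shows "pmf p x = g x"
proof -
  have "(\<Sum>x\<in>A. pmf p x) \<le> (\<Sum>x\<in>A. g x)"
    using assms(1,3) measure_pmf.prob_le_1[of p A] by (simp add: measure_measure_pmf_finite)
  with sum_mono[of A g "pmf p"] assms(2) have "(\<Sum>x\<in>A. g x) = (\<Sum>x\<in>A. pmf p x)"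
    by fastforce
  from sum_mono_inv[OF this assms(2) assms(4,1)] show ?thesis
    by simp
qed

lemma spmf_repeat_until:
  assumes "x \<in> A" and "0 < measure_pmf.prob D A"
  shows "spmf (repeat_until D A) x = pmf D x / measure_pmf.prob D A"
proof -
  let ?s = "spmf (repeat_until D A) x"
  have "?s = (\<integral>y. spmf (if y \<in> A then return_spmf y else repeat_until D A) x \<partial>measure_pmf D)"
    by (subst repeat_until.simps) (simp add: bind_spmf_of_pmf pmf_bind)
  \<comment> \<open>An accepted \<open>y\<close> contributes only if \<open>y = x\<close>; a
    rejected one restarts the same loop and contributes \<open>?s\<close> again. Since
    \<open>x \<in> A\<close>, the point \<open>x\<close> itself is never rejected.\<close>
  also have "\<dots> = (\<integral>y. indicator {x} y + ?s * indicator (- A) y \<partial>measure_pmf D)"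
    using assms(1) by (intro Bochner_Integration.integral_cong) (auto simp: indicator_def)
  also have "\<dots> = pmf D x + ?s * measure_pmf.prob D (- A)"
    by (subst Bochner_Integration.integral_add)
      (auto simp: measure_pmf_single measure_pmf.emeasure_eq_measure)
  also have "measure_pmf.prob D (- A) = 1 - measure_pmf.prob D A"
    using measure_pmf.prob_compl[of A D] by (simp add: Compl_eq_Diff_UNIV)
  finally show ?thesis
    using assms(2) by (simp add: field_simps)
qed

section \<open>Completions and the recursion for their total weight\<close>

locale ordered_classes =
  fixes I :: "'v sortition" and F' :: "(nat \<Rightarrow> 'v) set" and f\<^sub>0 :: "nat \<Rightarrow> 'v"
    and M :: nat and \<omega> :: "nat \<Rightarrow> 'v fvec" and \<mu> :: "nat \<Rightarrow> real"
  assumes inj_omega: "inj_on \<omega> {1..M}"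
    and mu_pos: "\<And>i. i \<in> pool I \<Longrightarrow> 0 < \<mu> i"
begin

abbreviation "cls j \<equiv> members_with I F' (\<omega> j)"
abbreviation "rest \<equiv> members_from I F' M \<omega>"
abbreviation "compl_ok z U \<equiv> (\<lambda>p. z p + wvec_set I F' U p) \<in> Zbar I F' f\<^sub>0"
abbreviation "Phi \<equiv> phi I F' f\<^sub>0 M \<omega> \<mu>"
abbreviation "weight U \<equiv> \<Prod>i\<in>U. \<mu> i"

text \<open>The index set of the sum \<open>phi\<close>, named because membership in it is the
  invariant of the loop: a state with a completion has positive \<open>Phi\<close>, so its
  transition masses are well defined.\<close>

definition completions :: "nat \<Rightarrow> 'v fvec \<Rightarrow> nat set set" where
  "completions j z = {U. U \<subseteq> rest j \<and> compl_ok z U}"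

lemma Phi_eq: "Phi j z = (\<Sum>U\<in>completions j z. weight U)"
  by (simp add: phi_def completions_def)

lemma cls_subset_pool: "cls j \<subseteq> pool I"
  by (auto simp: members_with_def)

lemma rest_subset_pool: "rest j \<subseteq> pool I"
  by (auto simp: members_with_def members_from_def)

lemma finite_pool: "finite (pool I)"
  by (simp add: pool_def)

lemma finite_cls: "finite (cls j)"
  using cls_subset_pool finite_pool finite_subset by blast

lemma finite_rest: "finite (rest j)"
  using rest_subset_pool finite_pool finite_subset by blast

lemma weight_pos: "U \<subseteq> pool I \<Longrightarrow> 0 < weight U"
  by (auto intro!: prod_pos mu_pos)

lemma weight_cls_nonneg: "S \<subseteq> cls j \<Longrightarrow> 0 \<le> weight S"
  using cls_subset_pool by (intro order.strict_implies_order[OF weight_pos]) blast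

lemma finite_completions: "finite (completions j z)"
  unfolding completions_def using finite_rest by simp

lemma weight_completion_pos: "U \<in> completions j z \<Longrightarrow> 0 < weight U"
  using rest_subset_pool by (intro weight_pos) (auto simp: completions_def)

lemma Phi_nonneg: "0 \<le> Phi j z"
  unfolding Phi_eq by (intro sum_nonneg) (use weight_completion_pos in force)

lemma Phi_pos: "U \<in> completions j z \<Longrightarrow> 0 < Phi j z"
  unfolding Phi_eq using finite_completions weight_completion_pos by (intro sum_pos) auto

lemma rest_Suc: "j \<le> M \<Longrightarrow> rest j = cls j \<union> rest (Suc j)"
proof -
  assume "j \<le> M"
  then have "{j..M} = insert j {Suc j..M}"
    by auto
  then show ?thesis
    by (simp add: members_from_def)
qed

lemma cls_rest_disjoint: "1 \<le> j \<Longrightarrow> j \<le> M \<Longrightarrow> cls j \<inter> rest (Suc j) = {}"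
  using inj_omega by (force simp: members_from_def members_with_def inj_on_def)

text \<open>All members of class \<open>j\<close> have the same vector, so choosing \<open>S\<close>
  there changes the state only through \<open>card S\<close>.\<close>

lemma completions_split:
  assumes "1 \<le> j" "j \<le> M" "S \<subseteq> cls j" "V \<subseteq> rest (Suc j)"
  shows "S \<union> V \<in> completions j z \<longleftrightarrow> V \<in> completions (Suc j) (add_copies z (card S) (\<omega> j))"
proof -
  have fin: "finite S" "finite V"
    using assms finite_cls finite_rest finite_subset by blast+
  have disj: "S \<inter> V = {}"
    using assms cls_rest_disjoint[of j] by blast
  have "wvec_set I F' S = (\<lambda>p. card S * \<omega> j p)"
  proof
    fix p
    have "wvec_set I F' S p = (\<Sum>i\<in>S. \<omega> j p)"
      unfolding wvec_set_def using assms(3) by (intro sum.cong) (auto simp: members_with_def)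
    then show "wvec_set I F' S p = card S * \<omega> j p"
      by simp
  qed
  moreover have "wvec_set I F' (S \<union> V) p = wvec_set I F' S p + wvec_set I F' V p" for p
    unfolding wvec_set_def by (rule sum.union_disjoint[OF fin disj])
  ultimately have "(\<lambda>p. z p + wvec_set I F' (S \<union> V) p)
      = (\<lambda>p. add_copies z (card S) (\<omega> j) p + wvec_set I F' V p)"
    by (simp add: add_copies_def add.assoc)
  then show ?thesis
    using assms rest_Suc[of j] by (auto simp: completions_def)
qed

text \<open>A completion splits uniquely into its part in class \<open>j\<close> and its part in the
  later classes. Grouping the first parts by size yields the factor \<open>subset_weight\<close>,
  because the next state depends only on that size.\<close>

lemma Phi_rec:
  assumes j: "1 \<le> j" "j \<le> M"
  shows "(\<Sum>d | d \<le> card (cls j).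
      subset_weight I F' \<omega> \<mu> j d * Phi (j + 1) (add_copies z d (\<omega> j))) = Phi j z"
proof -
  let ?C = "\<lambda>S. completions (Suc j) (add_copies z (card S) (\<omega> j))"
  have "Phi j z = (\<Sum>(S, V) \<in> (SIGMA S:Pow (cls j). ?C S). weight S * weight V)"
    unfolding Phi_eq
  \<comment> \<open>Cases 1 and 3 say that cutting and joining are mutually inverse, 2 and 4 that
    each maps into the other index set, 5 that the weights agree.\<close>
  proof (rule sum.reindex_bij_witness[where i = "\<lambda>(S, V). S \<union> V"
        and j = "\<lambda>U. (U \<inter> cls j, U \<inter> rest (Suc j))"], goal_cases)
    case (1 U)
    then show ?case using rest_Suc[of j] j by (auto simp: completions_def)
  next
    case (2 U)
    then have "U = U \<inter> cls j \<union> U \<inter> rest (Suc j)"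
      using rest_Suc[of j] j by (auto simp: completions_def)
    with 2 completions_split[OF j, of "U \<inter> cls j" "U \<inter> rest (Suc j)" z] show ?case
      by auto
  next
    case (3 b)
    then show ?case using cls_rest_disjoint[OF j] by (auto simp: completions_def)
  next
    case (4 b)
    then show ?case using completions_split[OF j]
      by (auto simp: completions_def[of "Suc j"])
  next
    case (5 U)
    then have U: "U = U \<inter> cls j \<union> U \<inter> rest (Suc j)"
      using rest_Suc[of j] j by (auto simp: completions_def)
    have "weight (U \<inter> cls j \<union> U \<inter> rest (Suc j))
        = weight (U \<inter> cls j) * weight (U \<inter> rest (Suc j))"
      using cls_rest_disjoint[OF j] finite_cls finite_rest
      by (intro prod.union_disjoint) auto
    with U show ?case by simp
  qed
  also have "\<dots> = (\<Sum>S\<in>Pow (cls j). weight S * Phi (Suc j) (add_copies z (card S) (\<omega> j)))"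
    using finite_cls finite_completions
    by (simp add: sum.Sigma[symmetric] Phi_eq sum_distrib_left)
  also have "\<dots> = (\<Sum>d | d \<le> card (cls j). \<Sum>S | S \<in> Pow (cls j) \<and> card S = d.
      weight S * Phi (Suc j) (add_copies z (card S) (\<omega> j)))"
    using finite_cls by (intro sum.group[symmetric]) (auto intro: card_mono)
  also have "\<dots> = (\<Sum>d | d \<le> card (cls j).
      subset_weight I F' \<omega> \<mu> j d * Phi (j + 1) (add_copies z d (\<omega> j)))"
    by (simp add: subset_weight_def sum_distrib_right)
  finally show ?thesis ..
qed

section \<open>Transition masses and output law of exact sampling\<close>

lemma subset_weight_nonneg: "0 \<le> subset_weight I F' \<omega> \<mu> j d"
  unfolding subset_weight_def by (intro sum_nonneg) (use weight_cls_nonneg in blast)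

text \<open>The size is given as \<open>card S\<close> because some subset of that size must exist;
  for larger sizes the sum is empty.\<close>

lemma subset_weight_pos:
  assumes "S \<subseteq> cls j"
  shows "0 < subset_weight I F' \<omega> \<mu> j (card S)"
  unfolding subset_weight_def
proof (rule sum_pos2)
  show "0 < weight S"
    using assms cls_subset_pool by (intro weight_pos) blast
  show "0 \<le> weight T" if "T \<in> {T. T \<subseteq> cls j \<and> card T = card S}" for T
    using that weight_cls_nonneg by blast
qed (use assms finite_cls in auto)

text \<open>\<open>Phi_rec\<close> is exactly the statement that these masses sum to 1.\<close>

lemma pmf_count_dist:
  assumes "1 \<le> j" "j \<le> M" "0 < Phi j z" "d \<le> card (cls j)"
  shows "pmf (count_dist I F' f\<^sub>0 M \<omega> \<mu> j z) d
    = subset_weight I F' \<omega> \<mu> j d * Phi (j + 1) (add_copies z d (\<omega> j)) / Phi j z"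
  unfolding count_dist_def using assms Phi_rec[OF assms(1,2), of z]
  by (subst pmf_embed_pmf_finite) (auto intro!: mult_nonneg_nonneg subset_weight_nonneg Phi_nonneg)

lemma pmf_subset_dist:
  assumes "S \<subseteq> cls j"
  shows "pmf (subset_dist I F' \<omega> \<mu> j (card S)) S
    = weight S / subset_weight I F' \<omega> \<mu> j (card S)"
  unfolding subset_dist_def using assms subset_weight_pos[OF assms] finite_cls[of j]
  by (subst pmf_embed_pmf_finite) (auto simp: subset_weight_def intro: weight_cls_nonneg)

text \<open>The induction runs downwards from \<open>Suc M\<close>, with the accumulated set
  \<open>P\<close> arbitrary. An inequality is the right form for arbitrary \<open>P\<close>, since
  different completions may have the same union with it.\<close>

lemma pmf_exact_sampling_loop_ge:
  assumes "1 \<le> j" "j \<le> Suc M" "U \<in> completions j z"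
  shows "weight U / Phi j z \<le> pmf (exact_sampling_loop I F' f\<^sub>0 M \<omega> \<mu> j z P) (P \<union> U)"
  using assms(2,1,3)
proof (induction j arbitrary: z P U rule: inc_induct)
  \<comment> \<open>No class is left, so the completion is empty and \<open>Phi\<close> is the empty
    product 1.\<close>
  case base
  then have "completions (Suc M) z = {{}}" "U = {}"
    by (auto simp: completions_def members_from_def)
  then show ?case
    by (simp add: exact_sampling_loop.simps Phi_eq)
next
  case (step j)
  define S where "S = U \<inter> cls j"
  define V where "V = U \<inter> rest (Suc j)"
  define z' where "z' = add_copies z (card S) (\<omega> j)"
  let ?C = "subset_weight I F' \<omega> \<mu> j (card S)"
  let ?loop = "exact_sampling_loop I F' f\<^sub>0 M \<omega> \<mu>"
  let ?tail = "\<lambda>d. bind_pmf (subset_dist I F' \<omega> \<mu> j d)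
    (\<lambda>S. ?loop (j + 1) (add_copies z d (\<omega> j)) (P \<union> S))"
  have j: "1 \<le> j" "j \<le> M"
    using step by auto
  have SV: "S \<subseteq> cls j" "V \<subseteq> rest (Suc j)"
    by (auto simp: S_def V_def)
  have U: "U = S \<union> V"
    using step.prems rest_Suc[OF j(2)] by (auto simp: completions_def S_def V_def)
  have V: "V \<in> completions (Suc j) z'"
    using completions_split[OF j SV, of z] step.prems(2) unfolding z'_def U by blast
  have pos: "0 < ?C" "0 < Phi (Suc j) z'" "0 < Phi j z"
    using subset_weight_pos[OF SV(1)] Phi_pos[OF V] Phi_pos[OF step.prems(2)] by auto
  have "weight U = weight S * weight V"
    unfolding U using cls_rest_disjoint[OF j] finite_cls finite_rest
    by (intro prod.union_disjoint) (use SV in \<open>auto intro: finite_subset\<close>)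
  \<comment> \<open>The inserted factors \<open>?C\<close> and \<open>Phi (Suc j) z'\<close> cancel;
    this is the telescoping.\<close>
  then have "weight U / Phi j z
      = ?C * Phi (Suc j) z' / Phi j z * (weight S / ?C * (weight V / Phi (Suc j) z'))"
    using pos by simp
  also have "\<dots> = pmf (count_dist I F' f\<^sub>0 M \<omega> \<mu> j z) (card S)
      * (pmf (subset_dist I F' \<omega> \<mu> j (card S)) S * (weight V / Phi (Suc j) z'))"
    using pmf_count_dist[OF j pos(3), of "card S"] pmf_subset_dist[OF SV(1)] SV(1) finite_cls
    by (simp add: z'_def card_mono)
  also have "\<dots> \<le> pmf (count_dist I F' f\<^sub>0 M \<omega> \<mu> j z) (card S)
      * (pmf (subset_dist I F' \<omega> \<mu> j (card S)) S * pmf (?loop (j + 1) z' (P \<union> S)) (P \<union> U))"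
    using step.IH[OF _ V, of "P \<union> S"] by (intro mult_left_mono) (auto simp: U Un_assoc)
  \<comment> \<open>Two applications of \<open>pmf_bind_ge\<close> follow: the first keeps only the
    draw \<open>S\<close>, the second only the count \<open>card S\<close>.\<close>
  also have "\<dots> \<le> pmf (count_dist I F' f\<^sub>0 M \<omega> \<mu> j z) (card S) * pmf (?tail (card S)) (P \<union> U)"
    unfolding z'_def by (intro mult_left_mono pmf_bind_ge) auto
  also have "\<dots> \<le> pmf (bind_pmf (count_dist I F' f\<^sub>0 M \<omega> \<mu> j z) ?tail) (P \<union> U)"
    by (rule pmf_bind_ge)
  also have "\<dots> = pmf (?loop j z P) (P \<union> U)"
    using j by (simp add: exact_sampling_loop.simps[of _ _ _ _ _ _ j])
  finally show ?case .
qed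

lemma pmf_exact_sampling:
  assumes "U \<in> completions 1 (\<lambda>_. 0)"
  shows "pmf (exact_sampling I F' f\<^sub>0 M \<omega> \<mu>) U = weight U / Phi 1 (\<lambda>_. 0)"
proof (rule pmf_eq_if_le_sum_1[OF finite_completions _ _ assms])
  show "weight T / Phi 1 (\<lambda>_. 0) \<le> pmf (exact_sampling I F' f\<^sub>0 M \<omega> \<mu>) T"
    if "T \<in> completions 1 (\<lambda>_. 0)" for T
    using pmf_exact_sampling_loop_ge[OF _ _ that, of "{}"] by (simp add: exact_sampling_def)
  show "(\<Sum>T\<in>completions 1 (\<lambda>_. 0). weight T / Phi 1 (\<lambda>_. 0)) = 1"
    using Phi_pos[OF assms] by (simp add: Phi_eq flip: sum_divide_distrib)
qed

end

section \<open>Panels as completions, and the accepted law\<close>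

lemma wvec_set_eq_card:
  assumes "finite U"
  shows "wvec_set I F' U (f, v) = (if (f, v) \<in> feature_values I F' then card {i\<in>U. f i = v} else 0)"
  using assms by (simp add: wvec_set_def wvec_def sum.If_cases Int_def)

text \<open>The quotas for \<open>F'\<close> are among those a panel satisfies. Every member has
  exactly one value of \<open>f\<^sub>0\<close>, so the coordinates for \<open>f\<^sub>0\<close> add
  up to the panel size.\<close>

lemma wvec_set_panel_in_Zbar:
  assumes "sortition_instance I" "F' \<subseteq> features I" "f\<^sub>0 \<in> F'" "P \<in> panels I"
  shows "wvec_set I F' P \<in> Zbar I F' f\<^sub>0"
proof -
  have P: "P \<subseteq> pool I" "card P = panel_size I" "finite P"
    using assms(4) by (auto simp: panels_def pool_def intro: finite_subset)
  have f0: "finite (vals I f\<^sub>0)" "f\<^sub>0 ` P \<subseteq> vals I f\<^sub>0"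
    using assms P by (auto simp: sortition_instance_def)
  have "(\<Sum>v\<in>vals I f\<^sub>0. wvec_set I F' P (f\<^sub>0, v)) = (\<Sum>v\<in>vals I f\<^sub>0. card {i\<in>P. f\<^sub>0 i = v})"
    using assms(3) P(3) by (simp add: wvec_set_eq_card feature_values_def)
  also have "\<dots> = card P"
    unfolding card_eq_sum by (rule sum.group[OF P(3) f0])
  finally show ?thesis
    using assms P by (auto simp: Zbar_def wvec_set_eq_card feature_values_def panels_def)
qed

theorem theoremA4:
  fixes I :: "'v sortition" and \<mu> :: "nat \<Rightarrow> real"
    and F' :: "(nat \<Rightarrow> 'v) set" and f\<^sub>0 :: "nat \<Rightarrow> 'v"
    and M :: nat and \<omega> :: "nat \<Rightarrow> 'v fvec"
  assumes "sortition_instance I"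
    and "panels I \<noteq> {}"
    and "\<And>i. i \<in> pool I \<Longrightarrow> \<mu> i > 0"
    and "F' \<subseteq> features I" and "F' \<noteq> {}"
    and "f\<^sub>0 \<in> F'"
    and "bij_betw \<omega> {1..M} (wvec I F' ` pool I)"
  shows "\<forall>P\<in>panels I.
    spmf (weighted_max_entropy I F' f\<^sub>0 M \<omega> \<mu>) P
      = (\<Prod>i\<in>P. \<mu> i) / (\<Sum>Q\<in>panels I. \<Prod>i\<in>Q. \<mu> i)"
proof
  interpret ordered_classes I F' f\<^sub>0 M \<omega> \<mu>
    using assms(3,7) by unfold_locales (auto simp: bij_betw_def)
  let ?D = "exact_sampling I F' f\<^sub>0 M \<omega> \<mu>"
  let ?phi = "Phi 1 (\<lambda>_. 0)"
  have "wvec I F' ` pool I = \<omega> ` {1..M}"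
    using assms(7) by (simp add: bij_betw_def)
  \<comment> \<open>Surjectivity of the ordering enters here: every pool member lies in some
    class.\<close>
  then have "pool I \<subseteq> rest 1"
    by (fastforce simp: members_from_def members_with_def)
  \<comment> \<open>Every panel is a possible sample. Samples respect only the quotas for
    \<open>F'\<close>, so the inclusion may be strict, which is why rejection follows.\<close>
  then have panels: "panels I \<subseteq> completions 1 (\<lambda>_. 0)"
    using wvec_set_panel_in_Zbar[OF assms(1,4,6)] by (auto simp: completions_def panels_def)
  then have fin: "finite (panels I)"
    using finite_completions finite_subset by blast
  fix P assume P: "P \<in> panels I"
  have phi: "0 < ?phi"
    using panels P Phi_pos by blast
  have "(\<Sum>Q\<in>panels I. weight Q) > 0"
    using fin assms(2) panels weight_completion_pos by (intro sum_pos) blast+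
  moreover have "measure_pmf.prob ?D (panels I) = (\<Sum>Q\<in>panels I. weight Q) / ?phi"
    using panels by (simp add: measure_measure_pmf_finite[OF fin] sum_divide_distrib
        pmf_exact_sampling subset_iff)
  \<comment> \<open>The normaliser \<open>?phi\<close> divides both the mass of \<open>P\<close> and
    the acceptance probability, and cancels.\<close>
  ultimately show "spmf (weighted_max_entropy I F' f\<^sub>0 M \<omega> \<mu>) P = weight P / (\<Sum>Q\<in>panels I. weight Q)"
    unfolding weighted_max_entropy_def using phi P panels
    by (subst spmf_repeat_until) (auto simp: pmf_exact_sampling subset_iff)
qed

end
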